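(* Let $K, C$ be integers with $1\le C<K$, let $\omega\ge 0$ be an integer, and let $\lambda>0$ and $0<\gamma\le\mu<+\infty$ be real numbers. Let $\mathbb{S}_{\mathbf{p}}$ be the set of all probability vectors $\mathbf{p}=(p_0,p_1,\dots,p_K)$ (i.e. $p_k\ge 0$ for all $k$ and $\mathbf{p}e=\sum_{k=0}^K p_k=1$) with $p_0<1$ and $p_K<1$ such that $$\mathbf{p}\mathbf{V}_{\mathbf{p}}=0,$$ where the matrix $\mathbf{V}_{\mathbf{p}}$ is defined in the context. Then $|\mathbb{S}_{\mathbf{p}}|=1$; that is, the fixed point $\mathbf{p}$ exists and is unique.
   Context: For a row vector $\mathbf{p}=(p_0,\dots,p_K)$ with $p_0\neq 1$ and $p_K\ne 1$ set $$a(\mathbf{p})=\frac{\mu}{1-p_K}\Big(C-\sum_{k=1}^K k p_k\Big),\qquad b(\mathbf{p})=\lambda+\gamma p_0\frac{1-p_0^{\omega}}{1-p_0},\qquad c(\mathbf{p})=a(\mathbf{p})+b(\mathbf{p}).$$ $\mathbf{V}_{\mathbf{p}}$ is the tridiagonal $(K+1)\times(K+1)$ matrix with rows and columns indexed by $0,\dots,K$, with superdiagonal entries all equal to $a(\mathbf{p})$, subdiagonal entries all equal to $b(\mathbf{p})$, and diagonal entries $-a(\mathbf{p})$ (row $0$), $-c(\mathbf{p})$ (rows $1,\dots,K-1$), $-b(\mathbf{p})$ (row $K$). $e$ is the column vector of ones. (Interpretation: $K$ is the number of parking positions and $C$ the initial number of bikes per station, $\lambda,\gamma,\mu$ are the arrival,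 walk and bike-riding rates, and $\omega$ is the maximal number of consecutive walks.) *)

theory Defs
  imports Complex_Main "Jordan_Normal_Form.Matrix"
begin

definition rate_a :: "nat \<Rightarrow> nat \<Rightarrow> real \<Rightarrow> real vec \<Rightarrow> real" where
  "rate_a K C \<mu> p = \<mu> / (1 - p $ K) * (real C - (\<Sum>k=1..K. real k * p $ k))"

definition rate_b :: "nat \<Rightarrow> real \<Rightarrow> real \<Rightarrow> real vec \<Rightarrow> real" where
  "rate_b \<omega> lam \<gamma> p = lam + \<gamma> * (p $ 0) * ((1 - (p $ 0) ^ \<omega>) / (1 - p $ 0))"

definition rate_c :: "nat \<Rightarrow> nat \<Rightarrow> nat \<Rightarrow> real \<Rightarrow> real \<Rightarrow> real \<Rightarrow> real vec \<Rightarrow> real" where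
  "rate_c K C \<omega> lam \<gamma> \<mu> p = rate_a K C \<mu> p + rate_b \<omega> lam \<gamma> p"

(* The case order puts row 0 before row K; for K = 0 the two would coincide, but K >= 2
   wherever this matrix is used. *)
definition V_mat :: "nat \<Rightarrow> nat \<Rightarrow> nat \<Rightarrow> real \<Rightarrow> real \<Rightarrow> real \<Rightarrow> real vec \<Rightarrow> real mat" where
  "V_mat K C \<omega> lam \<gamma> \<mu> p = mat (K + 1) (K + 1) (\<lambda>(i, j).
     if j = i + 1 then rate_a K C \<mu> p
     else if i = j + 1 then rate_b \<omega> lam \<gamma> p
     else if i = j then
       (if i = 0 then - rate_a K C \<mu> p
        else if i = K then - rate_b \<omega> lam \<gamma> p
        else - rate_c K C \<omega> lam \<gamma> \<mu> p)
     else 0)"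

definition prob_vec :: "nat \<Rightarrow> real vec \<Rightarrow> bool" where
  "prob_vec K p \<longleftrightarrow> p \<in> carrier_vec (K + 1) \<and> (\<forall>k\<le>K. 0 \<le> p $ k) \<and> (\<Sum>k=0..K. p $ k) = 1"

(* p is a row vector, hence the 1 x (K+1) matrix mat_of_row p.  The bounds on p_0 and p_K keep
   the denominators in rate_a and rate_b nonzero. *)
definition fixed_points :: "nat \<Rightarrow> nat \<Rightarrow> nat \<Rightarrow> real \<Rightarrow> real \<Rightarrow> real \<Rightarrow> real vec set" where
  "fixed_points K C \<omega> lam \<gamma> \<mu> =
     {p. prob_vec K p \<and> p $ 0 < 1 \<and> p $ K < 1 \<and>
         mat_of_row p * V_mat K C \<omega> lam \<gamma> \<mu> p = 0\<^sub>m 1 (K + 1)}"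

end

theory Submission
  imports Defs
begin

text \<open>
  The equation \<open>p V = 0\<close> is detailed balance \<open>a p\<^sub>k = b p\<^sub>k\<^sub>+\<^sub>1\<close>, so \<open>p\<close> is a truncated geometric
  distribution with ratio \<open>x = a / b > 0\<close>.  As \<open>x (1 - p\<^sub>K) = 1 - p\<^sub>0\<close>, the self-consistency
  condition \<open>a(p) = x b(p)\<close> becomes the scalar equation
  \<open>C = E[X] + (\<lambda> (1 - p\<^sub>0) + \<gamma> (p\<^sub>0 - p\<^sub>0^(\<omega>+1))) / \<mu>\<close>,
  where \<open>X\<close> has law \<open>p\<close>.  Writing \<open>E[X] = (1 - p\<^sub>0) + E[(X - 1)\<^sup>+]\<close>, the second summand is
  nondecreasing in \<open>x\<close> by stochastic monotonicity, while the remaining function of \<open>p\<^sub>0\<close> is strictly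
  decreasing because \<open>\<gamma> \<le> \<mu>\<close>, and \<open>p\<^sub>0\<close> is strictly decreasing in \<open>x\<close>.  The right-hand side is
  \<open>0\<close> at \<open>x = 0\<close> and exceeds \<open>K - 1 \<ge> C\<close> for large \<open>x\<close>.
\<close>

section \<open>Truncated geometric sums and means\<close>

definition geom_total :: "nat \<Rightarrow> real \<Rightarrow> real" where
  "geom_total K x = (\<Sum>k\<le>K. x ^ k)"

text \<open>The weight \<open>f\<close> is left general because the mean is needed both for k itself
  and for the positive part of k - 1.\<close>

definition geom_mean :: "(nat \<Rightarrow> real) \<Rightarrow> nat \<Rightarrow> real \<Rightarrow> real" where
  "geom_mean f K x = (\<Sum>k\<le>K. f k * x ^ k) / geom_total K x"

definition geom_vec :: "nat \<Rightarrow> real \<Rightarrow> real vec" where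
  "geom_vec K x = vec (K + 1) (\<lambda>k. x ^ k / geom_total K x)"

text \<open>Here \<open>1 / geom_total K x\<close> is p_0. Multiplying \<open>rate_b\<close> by 1 -
  p_0 clears its denominator, which gives the power \<open>Suc \<omega>\<close>.\<close>

definition balance :: "nat \<Rightarrow> nat \<Rightarrow> real \<Rightarrow> real \<Rightarrow> real \<Rightarrow> real \<Rightarrow> real" where
  "balance K \<omega> lam \<gamma> \<mu> x = geom_mean real K x +
     (lam * (1 - 1 / geom_total K x) +
      \<gamma> * (1 / geom_total K x - (1 / geom_total K x) ^ Suc \<omega>)) / \<mu>"

lemma geom_total_ge_1: "0 \<le> x \<Longrightarrow> 1 \<le> geom_total K x"
  unfolding geom_total_def
  by (subst sum.atMost_shift) (simp add: sum_nonneg)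

lemma geom_total_pos: "0 \<le> x \<Longrightarrow> 0 < geom_total K x"
  using geom_total_ge_1[of x K] by linarith

lemma geom_total_0: "geom_total K 0 = 1"
  unfolding geom_total_def by (subst sum.atMost_shift) simp

lemma geom_total_strict_mono:
  assumes "0 \<le> x" "x < y" "0 < K"
  shows "geom_total K x < geom_total K y"
  unfolding geom_total_def
proof (rule sum_strict_mono_ex1)
  show "\<exists>k\<in>{..K}. x ^ k < y ^ k"
    using assms by (intro bexI[of _ 1]) auto
qed (use assms in \<open>auto intro: power_mono\<close>)

text \<open>Chebyshev-style symmetrization: after cross-multiplying, the difference
  \<open>?D\<close> is a double sum, and adding its copy with indices swapped gives terms that are
  products of two factors, both having the sign of k - j (or vanishing).\<close>

lemma geom_mean_mono:
  assumes "mono f" "0 \<le> x" "x \<le> y"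
  shows "geom_mean f K x \<le> geom_mean f K y"
proof -
  let ?D = "(\<Sum>k\<le>K. f k * y ^ k) * (\<Sum>j\<le>K. x ^ j) - (\<Sum>k\<le>K. f k * x ^ k) * (\<Sum>j\<le>K. y ^ j)"
  have D: "?D = (\<Sum>k\<le>K. \<Sum>j\<le>K. f k * (y ^ k * x ^ j - x ^ k * y ^ j))"
    unfolding sum_product sum_subtractf[symmetric] by (simp add: algebra_simps)
  have D': "?D = (\<Sum>k\<le>K. \<Sum>j\<le>K. f j * (y ^ j * x ^ k - x ^ j * y ^ k))"
    unfolding D by (rule sum.swap)
  have "2 * ?D = (\<Sum>k\<le>K. \<Sum>j\<le>K. (f k - f j) * (y ^ k * x ^ j - x ^ k * y ^ j))"
    unfolding mult_2 by (subst (1) D, subst D') (simp add: sum.distrib[symmetric] algebra_simps)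
  also have "\<dots> \<ge> 0"
  proof (intro sum_nonneg)
    have le: "x ^ k * y ^ j \<le> y ^ k * x ^ j" if "j \<le> k" for j k
    proof -
      have "x ^ j * y ^ j * x ^ (k - j) \<le> x ^ j * y ^ j * y ^ (k - j)"
        using assms by (intro mult_left_mono power_mono) auto
      then show ?thesis
        using that by (auto simp: le_iff_add power_add algebra_simps)
    qed
    show "0 \<le> (f k - f j) * (y ^ k * x ^ j - x ^ k * y ^ j)" for j k
    proof (cases "j \<le> k")
      case True
      then show ?thesis
        using le[of j k] monoD[OF assms(1) True] by simp
    next
      case False
      then have "k \<le> j" by simp
      then show ?thesis
        using le[of k j] monoD[OF assms(1), of k j]
        by (intro mult_nonpos_nonpos) (simp_all add: algebra_simps)
    qed
  qed
  finally have "0 \<le> ?D" by simp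
  then show ?thesis
    using geom_total_pos[of x K] geom_total_pos[of y K] assms
    by (simp add: geom_mean_def geom_total_def[symmetric] divide_simps)
qed

text \<open>Subtraction on naturals truncates, so \<open>real k\<close> and
  \<open>real (k - 1)\<close> agree at k = 0 and differ by one elsewhere. The excess is the total
  without its constant term.\<close>

lemma geom_mean_real_split:
  assumes "0 \<le> x"
  shows "geom_mean real K x = 1 - 1 / geom_total K x + geom_mean (\<lambda>k. real (k - 1)) K x"
proof -
  have "(\<Sum>k\<le>K. real k * x ^ k) = (\<Sum>k\<le>K. real (k - 1) * x ^ k) + (geom_total K x - 1)"
    unfolding geom_total_def by (induction K) (auto simp: algebra_simps)
  then show ?thesis
    using geom_total_pos[OF assms, of K] by (simp add: geom_mean_def add_divide_distrib diff_divide_distrib)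
qed

section \<open>The scalar equation: monotonicity and existence of a root\<close>

lemma balance_strict_mono:
  assumes "0 < K" "0 < lam" "0 < \<gamma>" "\<gamma> \<le> \<mu>" "0 \<le> x" "x < y"
  shows "balance K \<omega> lam \<gamma> \<mu> x < balance K \<omega> lam \<gamma> \<mu> y"
proof -
  define q r where "q = 1 / geom_total K x" and "r = 1 / geom_total K y"
  have r: "0 < r" "r < q"
    using geom_total_strict_mono[of x y K] geom_total_pos[of x K] geom_total_pos[of y K] assms
    by (auto simp: q_def r_def intro!: divide_strict_left_mono)
  \<comment> \<open>Here u stands for p_0 and v for its power. Collecting the terms leaves u with
    the coefficient \<open>\<mu> - \<gamma>\<close>, nonnegative by assumption.\<close>
  have algebra: "1 - u + m + (lam * (1 - u) + \<gamma> * (u - v)) / \<mu>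
      = m + 1 + lam / \<mu> - ((\<mu> - \<gamma>) * u + \<gamma> * v + lam * u) / \<mu>" for u v m :: real
    using assms by (simp add: field_simps)
  have split: "balance K \<omega> lam \<gamma> \<mu> z = geom_mean (\<lambda>k. real (k - 1)) K z + 1 + lam / \<mu>
      - ((\<mu> - \<gamma>) * (1 / geom_total K z) + \<gamma> * (1 / geom_total K z) ^ Suc \<omega>
         + lam * (1 / geom_total K z)) / \<mu>"
    if "0 \<le> z" for z
    unfolding balance_def geom_mean_real_split[OF that] by (rule algebra)
  \<comment> \<open>The first two summands are compared weakly; strictness comes from the summand
    with \<open>lam\<close>.\<close>
  have "(\<mu> - \<gamma>) * r + \<gamma> * r ^ Suc \<omega> + lam * r < (\<mu> - \<gamma>) * q + \<gamma> * q ^ Suc \<omega> + lam * q"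
    using r assms
    by (intro add_le_less_mono add_mono mult_left_mono power_mono mult_strict_left_mono) auto
  then have "((\<mu> - \<gamma>) * r + \<gamma> * r ^ Suc \<omega> + lam * r) / \<mu>
      < ((\<mu> - \<gamma>) * q + \<gamma> * q ^ Suc \<omega> + lam * q) / \<mu>"
    using assms by (intro divide_strict_right_mono) auto
  moreover have "geom_mean (\<lambda>k. real (k - 1)) K x \<le> geom_mean (\<lambda>k. real (k - 1)) K y"
    using assms by (intro geom_mean_mono) (auto simp: mono_def)
  ultimately show ?thesis
    using assms by (simp add: split q_def[symmetric] r_def[symmetric] del: power_Suc)
qed

text \<open>The deficit K - E[X] has as numerator K terms below the top degree, each at most K
  x^(K-1). With x = K^2 these add up to at most x^K, hence to at most the total.\<close>

lemma geom_mean_large: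
  "geom_mean real K ((real K)\<^sup>2) \<ge> real K - 1"
proof (cases "K = 0")
  case True
  then show ?thesis by (simp add: geom_mean_def)
next
  case False
  define x where "x = (real K)\<^sup>2"
  have x1: "1 \<le> x" using False by (simp add: x_def)
  have "real K * geom_total K x - (\<Sum>k\<le>K. real k * x ^ k) = (\<Sum>k\<le>K. (real K - real k) * x ^ k)"
    by (simp add: geom_total_def sum_distrib_left sum_subtractf[symmetric] algebra_simps)
  also have "\<dots> = (\<Sum>k<K. (real K - real k) * x ^ k)"
    by (simp add: lessThan_Suc_atMost[symmetric])
  also have "\<dots> \<le> (\<Sum>k<K. real K * x ^ (K - 1))"
    using x1 by (intro sum_mono mult_mono power_increasing) auto
  also have "\<dots> = x ^ K"
    using False by (cases K) (auto simp: x_def power2_eq_square)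
  also have "\<dots> \<le> geom_total K x"
    unfolding geom_total_def using x1 by (intro member_le_sum) auto
  finally show ?thesis
    using geom_total_pos[of x K] x1
    by (simp add: geom_mean_def x_def[symmetric] field_simps)
qed

lemma balance_root_exists:
  assumes "1 \<le> C" "C < K" "0 < lam" "0 < \<gamma>" "\<gamma> \<le> \<mu>"
  obtains x where "0 < x" "balance K \<omega> lam \<gamma> \<mu> x = real C"
proof -
  have "continuous_on {0..(real K)\<^sup>2} (geom_total K)"
    unfolding geom_total_def by (intro continuous_intros)
  moreover have "geom_total K z \<noteq> 0" if "0 \<le> z" for z
    using geom_total_pos[OF that, of K] by simp
  ultimately have cont: "continuous_on {0..(real K)\<^sup>2} (balance K \<omega> lam \<gamma> \<mu>)"
    unfolding balance_def geom_mean_def using assms by (intro continuous_intros) auto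
  have b0: "balance K \<omega> lam \<gamma> \<mu> 0 = 0"
    by (auto simp: balance_def geom_mean_def geom_total_0 intro!: sum.neutral)
  define q where "q = 1 / geom_total K ((real K)\<^sup>2)"
  have q: "0 \<le> q" "q \<le> 1"
    using geom_total_ge_1[of "(real K)\<^sup>2" K] by (auto simp: q_def)
  then have "q ^ Suc \<omega> \<le> q"
    using power_decreasing[of 1 "Suc \<omega>" q] by simp
  then have "0 \<le> (lam * (1 - q) + \<gamma> * (q - q ^ Suc \<omega>)) / \<mu>"
    using q assms by (intro divide_nonneg_nonneg add_nonneg_nonneg mult_nonneg_nonneg) auto
  then have "real C \<le> balance K \<omega> lam \<gamma> \<mu> ((real K)\<^sup>2)"
    using geom_mean_large[of K] assms unfolding balance_def q_def by linarith
  then obtain x where x: "0 \<le> x" "balance K \<omega> lam \<gamma> \<mu> x = real C"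
    using IVT'[OF _ _ _ cont, of "real C"] b0 by auto
  moreover have "x \<noteq> 0" using x b0 assms by auto
  ultimately show ?thesis using that[of x] by simp
qed

section \<open>Stationarity as detailed balance\<close>

lemma vec_mult_V_mat:
  assumes "p \<in> carrier_vec (K + 1)" "0 < K" "j \<le> K"
  shows "(mat_of_row p * V_mat K C \<omega> lam \<gamma> \<mu> p) $$ (0, j) =
    (if 0 < j then rate_a K C \<mu> p * p $ (j - 1) - rate_b \<omega> lam \<gamma> p * p $ j else 0)
    - (if j < K then rate_a K C \<mu> p * p $ j - rate_b \<omega> lam \<gamma> p * p $ (j + 1) else 0)"
proof -
  define a b where "a = rate_a K C \<mu> p" and "b = rate_b \<omega> lam \<gamma> p"
  have "(mat_of_row p * V_mat K C \<omega> lam \<gamma> \<mu> p) $$ (0, j) =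
      (\<Sum>i\<le>K. p $ i * V_mat K C \<omega> lam \<gamma> \<mu> p $$ (i, j))"
    using assms
    by (auto simp: scalar_prod_def V_mat_def lessThan_Suc_atMost atLeast0LessThan intro!: sum.cong)
  \<comment> \<open>For j = 0 the index \<open>j - 1\<close> truncates to 0, so the guard
    \<open>0 < j\<close> is what removes the spurious entry.\<close>
  also have "\<dots> = (\<Sum>i\<le>K. (if i = j - 1 then p $ i * (if 0 < j then a else 0) else 0)
      + (if i = j + 1 then p $ i * b else 0)
      - (if i = j then p $ i * ((if j < K then a else 0) + (if 0 < j then b else 0)) else 0))"
  proof (intro sum.cong refl)
    fix i assume "i \<in> {..K}"
    then have i: "i < K + 1" and j: "j < K + 1" using assms by auto
    consider "i = j" | "i + 1 = j" | "i = j + 1" | "i \<noteq> j" "i + 1 \<noteq> j" "i \<noteq> j + 1" by blast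
    then show "p $ i * V_mat K C \<omega> lam \<gamma> \<mu> p $$ (i, j) =
        (if i = j - 1 then p $ i * (if 0 < j then a else 0) else 0)
        + (if i = j + 1 then p $ i * b else 0)
        - (if i = j then p $ i * ((if j < K then a else 0) + (if 0 < j then b else 0)) else 0)"
    proof cases
      case 1
      then show ?thesis
        using i j assms(2) unfolding V_mat_def a_def b_def rate_c_def
        by (cases "j = 0"; cases "j = K") (auto simp: algebra_simps)
    next
      case 2
      then show ?thesis
        using i j unfolding V_mat_def a_def b_def by auto
    next
      case 3
      then show ?thesis
        using i j unfolding V_mat_def a_def b_def by auto
    next
      case 4
      then have "i = j - 1 \<longrightarrow> \<not> 0 < j" by auto
      then show ?thesis
        using 4 i j unfolding V_mat_def by auto
    qed
  qed
  also have "\<dots> = (if 0 < j then a * p $ (j - 1) - b * p $ j else 0)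
    - (if j < K then a * p $ j - b * p $ (j + 1) else 0)"
    using assms by (auto simp: sum.distrib sum_subtractf algebra_simps)
  finally show ?thesis unfolding a_def b_def .
qed

text \<open>Column j equates the net flow a p_(j-1) - b p_j across the cut below j with the one
  across the cut above j. Column 0 has no lower cut, so its flow is zero, and induction carries this
  zero to every cut.\<close>

lemma detailed_balance_iff:
  assumes "p \<in> carrier_vec (K + 1)" "0 < K"
  shows "mat_of_row p * V_mat K C \<omega> lam \<gamma> \<mu> p = 0\<^sub>m 1 (K + 1) \<longleftrightarrow>
    (\<forall>k<K. rate_a K C \<mu> p * p $ k = rate_b \<omega> lam \<gamma> p * p $ (k + 1))"
proof
  assume eq: "mat_of_row p * V_mat K C \<omega> lam \<gamma> \<mu> p = 0\<^sub>m 1 (K + 1)"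
  have col: "(if 0 < j then rate_a K C \<mu> p * p $ (j - 1) - rate_b \<omega> lam \<gamma> p * p $ j else 0)
    = (if j < K then rate_a K C \<mu> p * p $ j - rate_b \<omega> lam \<gamma> p * p $ (j + 1) else 0)"
    if "j \<le> K" for j
    using vec_mult_V_mat[OF assms that, of C \<omega> lam \<gamma> \<mu>] that unfolding eq by simp
  have "k < K \<longrightarrow> rate_a K C \<mu> p * p $ k = rate_b \<omega> lam \<gamma> p * p $ (k + 1)" for k
  proof (induction k)
    case 0
    then show ?case using col[of 0] assms(2) by simp
  next
    case (Suc k)
    then show ?case using col[of "Suc k"] by (cases "Suc k < K") auto
  qed
  then show "\<forall>k<K. rate_a K C \<mu> p * p $ k = rate_b \<omega> lam \<gamma> p * p $ (k + 1)" by blast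
next
  assume db: "\<forall>k<K. rate_a K C \<mu> p * p $ k = rate_b \<omega> lam \<gamma> p * p $ (k + 1)"
  show "mat_of_row p * V_mat K C \<omega> lam \<gamma> \<mu> p = 0\<^sub>m 1 (K + 1)"
  proof (rule eq_matI)
    fix i j assume "i < dim_row (0\<^sub>m 1 (K + 1) :: real mat)" "j < dim_col (0\<^sub>m 1 (K + 1) :: real mat)"
    then have "i = 0" "j \<le> K" by auto
    moreover have "rate_a K C \<mu> p * p $ (j - 1) = rate_b \<omega> lam \<gamma> p * p $ j" if "0 < j"
      using db[rule_format, of "j - 1"] that \<open>j \<le> K\<close> by simp
    ultimately show "(mat_of_row p * V_mat K C \<omega> lam \<gamma> \<mu> p) $$ (i, j) = 0\<^sub>m 1 (K + 1) $$ (i, j)"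
      using db by (simp add: vec_mult_V_mat[OF assms \<open>j \<le> K\<close>] del: index_mult_mat)
  qed (use assms in \<open>auto simp: V_mat_def\<close>)
qed

section \<open>Geometric vectors and fixed points\<close>

lemma geom_vec_simps:
  "geom_vec K x \<in> carrier_vec (K + 1)"
  "k \<le> K \<Longrightarrow> geom_vec K x $ k = x ^ k / geom_total K x"
  by (simp_all add: geom_vec_def)

lemma geom_vec_bounds:
  assumes "0 < x" "0 < K"
  shows "geom_vec K x $ 0 < 1" "geom_vec K x $ K < 1"
    "x * (1 - geom_vec K x $ K) = 1 - geom_vec K x $ 0"
proof -
  have S: "0 < geom_total K x" using assms geom_total_pos by simp
  show "geom_vec K x $ 0 < 1"
    using geom_total_strict_mono[of 0 x K] assms S by (simp add: geom_vec_simps geom_total_0)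
  have "geom_total K x = (\<Sum>k<K. x ^ k) + x ^ K"
    by (simp add: geom_total_def lessThan_Suc_atMost[symmetric])
  moreover have "geom_total K x = 1 + x * (\<Sum>k<K. x ^ k)"
    unfolding geom_total_def by (subst sum.atMost_shift) (simp add: sum_distrib_left)
  ultimately have "geom_total K x = 1 + x * (geom_total K x - x ^ K)" by simp
  then show eq: "x * (1 - geom_vec K x $ K) = 1 - geom_vec K x $ 0"
    using S by (simp add: geom_vec_simps field_simps)
  \<comment> \<open>The bound on p_K follows from the bound on p_0 through the identity just
    shown.\<close>
  have "0 < x * (1 - geom_vec K x $ K)"
    unfolding eq using \<open>geom_vec K x $ 0 < 1\<close> by simp
  then show "geom_vec K x $ K < 1"
    using assms by (simp add: zero_less_mult_iff)
qed

lemma prob_vec_geom_vec: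
  assumes "0 \<le> x"
  shows "prob_vec K (geom_vec K x)"
proof -
  have "(\<Sum>k\<le>K. geom_vec K x $ k) = (\<Sum>k\<le>K. x ^ k / geom_total K x)"
    by (intro sum.cong) (auto simp: geom_vec_simps)
  also have "\<dots> = 1"
    using geom_total_pos[OF assms, of K]
    by (simp add: sum_divide_distrib[symmetric] geom_total_def[symmetric])
  finally show ?thesis
    using assms geom_total_pos[OF assms, of K]
    by (auto simp: prob_vec_def geom_vec_def atLeast0AtMost)
qed

text \<open>Multiplying by 1 - p_K clears the denominator of \<open>rate_a\<close>; since x (1 -
  p_K) = 1 - p_0, the same factor clears that of \<open>rate_b\<close>.\<close>

lemma geom_vec_ratio_iff:
  assumes "0 < x" "0 < K" "0 < \<mu>"
  shows "rate_a K C \<mu> (geom_vec K x) = x * rate_b \<omega> lam \<gamma> (geom_vec K x) \<longleftrightarrow>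
    balance K \<omega> lam \<gamma> \<mu> x = real C"
proof -
  define p where "p = geom_vec K x"
  define q where "q = 1 / geom_total K x"
  have q: "p $ 0 = q" by (simp add: p_def q_def geom_vec_simps)
  note bd = geom_vec_bounds[OF assms(1,2), folded p_def, unfolded q]
  have "(\<Sum>k=1..K. real k * p $ k) = (\<Sum>k\<le>K. real k * p $ k)"
    by (intro sum.mono_neutral_left) (auto simp: not_less_eq_eq)
  also have "\<dots> = geom_mean real K x"
    unfolding geom_mean_def sum_divide_distrib
    by (intro sum.cong) (auto simp: p_def geom_vec_simps)
  finally have mean: "(\<Sum>k=1..K. real k * p $ k) = geom_mean real K x" .
  have "x * (1 - p $ K) * rate_b \<omega> lam \<gamma> p = lam * (1 - q) + \<gamma> * (q - q ^ Suc \<omega>)"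
    using bd unfolding bd(3) rate_b_def q by (simp add: field_simps)
  then have "\<mu> * balance K \<omega> lam \<gamma> \<mu> x =
      \<mu> * geom_mean real K x + x * (1 - p $ K) * rate_b \<omega> lam \<gamma> p"
    using assms unfolding balance_def q_def[symmetric] by (subst distrib_left) (simp del: power_Suc)
  moreover have "rate_a K C \<mu> p = x * rate_b \<omega> lam \<gamma> p \<longleftrightarrow>
      \<mu> * (real C - geom_mean real K x) = x * (1 - p $ K) * rate_b \<omega> lam \<gamma> p"
    using bd unfolding rate_a_def mean by (simp add: field_simps)
  ultimately have "rate_a K C \<mu> p = x * rate_b \<omega> lam \<gamma> p \<longleftrightarrow>
      \<mu> * balance K \<omega> lam \<gamma> \<mu> x = \<mu> * real C"
    unfolding right_diff_distrib by linarith
  then show ?thesis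
    using assms unfolding p_def by simp
qed

lemma geom_vec_fixed_point:
  assumes "0 < x" "0 < K" "0 < \<mu>" "balance K \<omega> lam \<gamma> \<mu> x = real C"
  shows "geom_vec K x \<in> fixed_points K C \<omega> lam \<gamma> \<mu>"
proof -
  have "\<forall>k<K. rate_a K C \<mu> (geom_vec K x) * geom_vec K x $ k =
      rate_b \<omega> lam \<gamma> (geom_vec K x) * geom_vec K x $ (k + 1)"
    using geom_vec_ratio_iff[OF assms(1-3), of C \<omega> lam \<gamma>] assms by (simp add: geom_vec_simps)
  then show ?thesis
    using assms geom_vec_bounds[OF assms(1,2)] prob_vec_geom_vec[of x K]
      detailed_balance_iff[OF geom_vec_simps(1) assms(2), of x C \<omega> lam \<gamma> \<mu>]
    by (simp add: fixed_points_def)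
qed

lemma rate_b_pos:
  assumes "0 < lam" "0 \<le> \<gamma>" "0 \<le> p $ 0" "p $ 0 < 1"
  shows "0 < rate_b \<omega> lam \<gamma> p"
  unfolding rate_b_def using assms
  by (intro add_pos_nonneg mult_nonneg_nonneg divide_nonneg_nonneg) (auto simp: power_le_one)

lemma fixed_point_is_geom_vec:
  assumes "0 < K" "0 < lam" "0 < \<gamma>" "0 < \<mu>" "p \<in> fixed_points K C \<omega> lam \<gamma> \<mu>"
  obtains x where "0 < x" "p = geom_vec K x" "balance K \<omega> lam \<gamma> \<mu> x = real C"
proof -
  have p: "p \<in> carrier_vec (K + 1)" "\<And>k. k \<le> K \<Longrightarrow> 0 \<le> p $ k" "(\<Sum>k\<le>K. p $ k) = 1" "p $ 0 < 1"
    and V: "mat_of_row p * V_mat K C \<omega> lam \<gamma> \<mu> p = 0\<^sub>m 1 (K + 1)"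
    using assms(5) by (auto simp: fixed_points_def prob_vec_def atLeast0AtMost)
  have b: "0 < rate_b \<omega> lam \<gamma> p"
    using assms p by (intro rate_b_pos) auto
  \<comment> \<open>The sign of \<open>rate_a\<close> is not known at this point, so positivity of x
    has to be derived from p below.\<close>
  define x where "x = rate_a K C \<mu> p / rate_b \<omega> lam \<gamma> p"
  have step: "p $ (k + 1) = x * p $ k" if "k < K" for k
    using detailed_balance_iff[OF p(1) assms(1)] V that b by (simp add: x_def field_simps)
  have pk: "p $ k = x ^ k * p $ 0" if "k \<le> K" for k
    using that
  proof (induction k)
    case (Suc k)
    then show ?case using step[of k] by simp
  qed simp
  have "(\<Sum>k\<le>K. p $ k) = (\<Sum>k\<le>K. x ^ k * p $ 0)"
    by (intro sum.cong) (auto intro: pk)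
  then have total: "geom_total K x * p $ 0 = 1"
    using p(3) by (simp add: geom_total_def sum_distrib_right)
  then have "p $ 0 \<noteq> 0" by auto
  then have p0: "0 < p $ 0" using p(2)[of 0] by simp
  \<comment> \<open>This product is p_1, which is nonnegative; x = 0 would put all mass at 0,
    against p_0 < 1.\<close>
  have "0 \<le> x * p $ 0"
    using step[of 0] p(2)[of 1] assms(1) by simp
  then have "0 \<le> x" using p0 by (simp add: zero_le_mult_iff)
  moreover have "x \<noteq> 0" using total p(4) by (auto simp: geom_total_0)
  ultimately have x: "0 < x" by simp
  have "p $ 0 = 1 / geom_total K x"
    using total geom_total_pos[of x K] x by (simp add: field_simps)
  then have "p $ k = x ^ k / geom_total K x" if "k \<le> K" for k
    using pk[OF that] by simp
  then have eq: "p = geom_vec K x"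
    using p(1) by (intro eq_vecI) (auto simp: geom_vec_def)
  have "rate_a K C \<mu> p = x * rate_b \<omega> lam \<gamma> p"
    using b by (simp add: x_def)
  then show ?thesis
    using that[OF x eq] geom_vec_ratio_iff[OF x assms(1,4)] eq by simp
qed

theorem theorem5:
  fixes K C \<omega> :: nat and lam \<gamma> \<mu> :: real
  assumes "1 \<le> C" and "C < K" and "0 < lam" and "0 < \<gamma>" and "\<gamma> \<le> \<mu>"
  shows "card (fixed_points K C \<omega> lam \<gamma> \<mu>) = 1"
proof -
  have K: "0 < K" and \<mu>: "0 < \<mu>" using assms by auto
  obtain x where x: "0 < x" "balance K \<omega> lam \<gamma> \<mu> x = real C"
    using balance_root_exists[OF assms] .
  have "p = geom_vec K x" if p: "p \<in> fixed_points K C \<omega> lam \<gamma> \<mu>" for p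
  proof -
    obtain y where y: "0 < y" "p = geom_vec K y" "balance K \<omega> lam \<gamma> \<mu> y = real C"
      using fixed_point_is_geom_vec[OF K assms(3,4) \<mu> p] .
    have "x = y"
      using balance_strict_mono[OF K assms(3-5), of x y \<omega>]
        balance_strict_mono[OF K assms(3-5), of y x \<omega>] x y by fastforce
    then show ?thesis using y by simp
  qed
  then have "fixed_points K C \<omega> lam \<gamma> \<mu> = {geom_vec K x}"
    using geom_vec_fixed_point[OF x(1) K \<mu> x(2)] by blast
  then show ?thesis by simp
qed

end
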